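(* Let $\xi,\xi_1,\xi_2,\ldots$ be independent identically distributed random variables taking values in $\{0,1,2,\ldots\}$ with $\mathbf{P}(\xi=i)=p_i>0$ for all $i\ge 0$, $\sum_{i\ge 0}p_i=1$. Let $\bar\xi_n$, $r(n)$, $a_n$ be as defined in the context, and let $l\ge 1$ be a fixed integer. Suppose that $r(n)$ is a monotonic function and $r(n)\to\infty$ as $n\to\infty$. Then: (i) for $l=1$, $$\mathbf{P}(\bar\xi_n\le a_n-l\ \text{ i.o.})=1;$$ (ii) if $l>1$, then the probability $$\mathbf{P}(\bar\xi_n\le a_n-l\ \text{ i.o.})$$ is equal to zero if the series $\sum_{k\ge 1}\exp\big(-\exp((l-1)\,r(k))\big)$ converges, and is equal to one if this series diverges.
   Context: For the i.i.d. sequence $\xi,\xi_1,\xi_2,\ldots$ set $\bar\xi_n=\max_{1\le i\le n}\xi_i$. For the distribution $(i,p_i)$, $i\ge0$, of $\xi$ define $$R(n)=-\ln\mathbf{P}(\xi\ge n)=-\ln\Big(\sum_{i\ge n}p_i\Big),\quad n\ge 0,\qquad r(n)=R(n)-R(n-1),\quad n\ge 1,$$ $$a_n=\max\Big(k\ge 0:\ \sum_{i\ge k}p_i\ge \frac1n\Big).$$ "i.o." means "infinitely often", i.e. the event occurs for infinitely many $n$. *)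

theory Defs
  imports "HOL-Probability.Probability"
begin

definition tail_sum :: "(nat \<Rightarrow> real) \<Rightarrow> nat \<Rightarrow> real"
  where "tail_sum p n = (\<Sum>i. p (n + i))"

definition R_fun :: "(nat \<Rightarrow> real) \<Rightarrow> nat \<Rightarrow> real"
  where "R_fun p n = - ln (tail_sum p n)"

(* Only the values at n \<ge> 1 are meaningful. *)
definition r_fun :: "(nat \<Rightarrow> real) \<Rightarrow> nat \<Rightarrow> real"
  where "r_fun p n = R_fun p n - R_fun p (n - 1)"

(* Only the values at n \<ge> 1 are meaningful: for n = 0, the set is infinite because 1 / 0 = 0. *)
definition a_seq :: "(nat \<Rightarrow> real) \<Rightarrow> nat \<Rightarrow> nat"
  where "a_seq p n = Max {k. tail_sum p k \<ge> 1 / real n}"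

(* The sequence is indexed from 1, so X 0 plays no role and n = 0 is a dummy value. *)
definition max_upto :: "(nat \<Rightarrow> 'a \<Rightarrow> nat) \<Rightarrow> nat \<Rightarrow> 'a \<Rightarrow> nat"
  where "max_upto X n \<omega> = Max ((\<lambda>i. X i \<omega>) ` {1..n})"

end

theory Submission imports Defs
begin

text \<open>Write \<open>G k\<close> for the tail \<open>P(\<xi> \<ge> k)\<close> and let \<open>T m\<close> be the first time \<open>n\<close> with
  \<open>a\<^sub>n \<ge> m + l\<close>, so \<open>T m \<approx> 1 / G (m + l)\<close>. As the running maximum is nondecreasing,
  the event in question occurs infinitely often iff the events
  \<open>low m\<close>, that the first \<open>T m\<close> variables are all at most \<open>m\<close>, do. Their probability
  \<open>(1 - G (m + 1)) ^ T m \<approx> exp (- exp (R (m + l) - R (m + 1)))\<close> is compared with the series using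
  the monotonicity of \<open>r\<close>. This gives the convergent case by Borel--Cantelli.
  For \<open>j + l \<le> k\<close>, the events \<open>low j\<close> and \<open>low k\<close> are asymptotically independent, as
  \<open>T j * G (k + 1)\<close> is of order \<open>exp (- r (k + 1))\<close>; hence Chebyshev's
  inequality for the number of occurrences gives the divergent case. The case \<open>l = 1\<close> is an
  instance of the latter, all terms of the series being \<open>exp (- 1)\<close>.\<close>

section \<open>Borel--Cantelli lemmas by the second moment method\<close>

text \<open>Chebyshev's inequality for the number \<open>Y\<close> of events that occur: if none
  does, \<open>Y\<close> misses its mean \<open>S\<close> by \<open>S\<close>. Pairs at distance at
  least \<open>l\<close> add at most \<open>\<epsilon> * S\<^sup>2\<close> to the variance, and the
  fewer than \<open>2 * l\<close> close partners of each index are absorbed by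
  \<open>2 * l * S\<close>.\<close>

lemma (in prob_space) prob_no_event_le:
  fixes A :: "nat \<Rightarrow> 'a set"
  assumes A: "\<And>k. A k \<in> events"
    and pair: "\<And>j k. m \<le> j \<Longrightarrow> j + l \<le> k \<Longrightarrow>
      prob (A j \<inter> A k) \<le> (1 + \<epsilon>) * (prob (A j) * prob (A k))"
    and \<epsilon>: "\<epsilon> \<ge> 0"
    and S: "S = (\<Sum>k\<in>{m..<n}. prob (A k))" "S > 0"
  shows "prob {\<omega>\<in>space M. \<forall>k\<in>{m..<n}. \<omega> \<notin> A k} \<le> \<epsilon> + 2 * real l / S"
proof -
  define Y where "Y = (\<lambda>\<omega>. \<Sum>k\<in>{m..<n}. indicator (A k) \<omega> :: real)"
  note [measurable] = A
  have [measurable]: "Y \<in> borel_measurable M"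
    unfolding Y_def by measurable
  have sq: "(\<lambda>\<omega>. (Y \<omega>)\<^sup>2) = (\<lambda>\<omega>. \<Sum>j\<in>{m..<n}. \<Sum>k\<in>{m..<n}. indicator (A j \<inter> A k) \<omega>)"
    by (simp add: Y_def power2_eq_square sum_product indicator_inter_arith)
  have intY: "integrable M Y"
    unfolding Y_def by (intro Bochner_Integration.integrable_sum integrable_real_indicator)
      (auto simp: emeasure_eq_measure)
  have intY2: "integrable M (\<lambda>\<omega>. (Y \<omega>)\<^sup>2)"
    unfolding sq by (intro Bochner_Integration.integrable_sum integrable_real_indicator)
      (auto simp: emeasure_eq_measure)
  have EY: "expectation Y = S"
    unfolding Y_def S(1)
    by (subst Bochner_Integration.integral_sum) (auto simp: emeasure_eq_measure)
  have EY2: "expectation (\<lambda>\<omega>. (Y \<omega>)\<^sup>2) = (\<Sum>j\<in>{m..<n}. \<Sum>k\<in>{m..<n}. prob (A j \<inter> A k))"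
    unfolding sq
    by (subst Bochner_Integration.integral_sum | subst integral_sum)+
      (auto simp: emeasure_eq_measure intro!: Bochner_Integration.integrable_sum)
  \<comment> \<open>The window around \<open>j\<close> contains every \<open>k\<close> closer than
    \<open>l\<close>; there the intersection is bounded crudely by \<open>prob (A j)\<close>.
    Outside it, \<open>pair\<close> applies to the two indices in increasing order.\<close>
  have pair': "prob (A j \<inter> A k) \<le> (1 + \<epsilon>) * (prob (A j) * prob (A k))
      + (if k \<in> {j-l..<j+l} then prob (A j) else 0)"
    if "m \<le> j" "m \<le> k" for j k
  proof (cases "k \<in> {j-l..<j+l}")
    case True
    have "prob (A j \<inter> A k) \<le> prob (A j)" by (intro finite_measure_mono) auto
    moreover have "0 \<le> (1 + \<epsilon>) * (prob (A j) * prob (A k))" using \<epsilon> by simp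
    ultimately show ?thesis using True by simp
  next
    case False
    then consider "j + l \<le> k" | "k + l \<le> j" by fastforce
    then show ?thesis
    proof cases
      case 1
      then show ?thesis using pair[of j k] that False by simp
    next
      case 2
      then have "prob (A j \<inter> A k) \<le> (1 + \<epsilon>) * (prob (A j) * prob (A k))"
        using pair[of k j] that by (simp add: Int_commute mult.commute)
      then show ?thesis using False by auto
    qed
  qed
  have "(\<Sum>k\<in>{m..<n}. prob (A j \<inter> A k)) \<le> (1 + \<epsilon>) * (prob (A j) * S) + 2 * real l * prob (A j)"
    if "j \<in> {m..<n}" for j
  proof -
    have "card ({m..<n} \<inter> {j-l..<j+l}) \<le> card {j-l..<j+l}"
      by (intro card_mono) auto
    also have "\<dots> \<le> 2 * l" by simp
    finally have card: "real (card ({m..<n} \<inter> {j-l..<j+l})) \<le> 2 * real l"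
      by linarith
    have "(\<Sum>k\<in>{m..<n}. prob (A j \<inter> A k)) \<le>
      (\<Sum>k\<in>{m..<n}. (1 + \<epsilon>) * (prob (A j) * prob (A k))
      + (if k \<in> {j-l..<j+l} then prob (A j) else 0))"
      using that by (intro sum_mono pair') auto
    also have "\<dots> = (1 + \<epsilon>) * (prob (A j) * S) +
        (\<Sum>k\<in>{m..<n}. if k \<in> {j-l..<j+l} then prob (A j) else 0)"
      by (simp add: sum.distrib S(1) sum_distrib_left)
    also have "(\<Sum>k\<in>{m..<n}. if k \<in> {j-l..<j+l} then prob (A j) else 0)
        = real (card ({m..<n} \<inter> {j-l..<j+l})) * prob (A j)"
      by (subst sum.inter_restrict[symmetric]) auto
    also have "\<dots> \<le> 2 * real l * prob (A j)"
      using card by (intro mult_right_mono) auto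
    finally show ?thesis by simp
  qed
  then have "expectation (\<lambda>\<omega>. (Y \<omega>)\<^sup>2) \<le>
      (\<Sum>j\<in>{m..<n}. (1 + \<epsilon>) * (prob (A j) * S) + 2 * real l * prob (A j))"
    unfolding EY2 by (intro sum_mono)
  also have "\<dots> = (1 + \<epsilon>) * S\<^sup>2 + 2 * real l * S"
    by (simp add: sum.distrib S(1)[symmetric] power2_eq_square
        flip: sum_distrib_left sum_distrib_right)
  finally have var: "variance Y \<le> \<epsilon> * S\<^sup>2 + 2 * real l * S"
    using variance_eq[OF intY intY2] by (simp add: EY algebra_simps)
  have "prob {\<omega>\<in>space M. \<forall>k\<in>{m..<n}. \<omega> \<notin> A k} \<le> prob {\<omega>\<in>space M. \<bar>Y \<omega> - expectation Y\<bar> \<ge> S}"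
    unfolding EY using S(2) by (intro finite_measure_mono) (auto simp: Y_def)
  also have "\<dots> \<le> variance Y / S\<^sup>2"
    using S(2) intY2 by (intro Chebyshev_inequality) auto
  also have "\<dots> \<le> (\<epsilon> * S\<^sup>2 + 2 * real l * S) / S\<^sup>2"
    by (intro divide_right_mono var) auto
  also have "\<dots> = \<epsilon> + 2 * real l / S"
    using S(2) by (simp add: field_simps power2_eq_square)
  finally show ?thesis .
qed

text \<open>The partial sums are nondecreasing, so if they fail to exceed some \<open>B\<close>
  eventually, all of them are bounded by \<open>B\<close>, and the shifted series converges.\<close>

lemma filterlim_partial_sums_at_top:
  fixes f :: "nat \<Rightarrow> real"
  assumes "\<And>k. f k \<ge> 0" "\<not> summable f"
  shows "filterlim (\<lambda>n. \<Sum>k\<in>{m..<n}. f k) at_top sequentially"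
proof -
  have "\<exists>n. \<forall>k\<ge>n. B \<le> (\<Sum>k\<in>{m..<k}. f k)" for B
  proof (rule ccontr)
    assume *: "\<not> ?thesis"
    have "(\<Sum>i<n. f (i + m)) \<le> B" for n
    proof -
      from * obtain k where k: "k \<ge> n + m" "(\<Sum>k\<in>{m..<k}. f k) < B" by fastforce
      have "(\<Sum>i<n. f (i + m)) = (\<Sum>k\<in>{m..<n+m}. f k)"
        using sum.shift_bounds_nat_ivl[of f 0 m n] by (simp add: atLeast0LessThan)
      also have "\<dots> \<le> (\<Sum>k\<in>{m..<k}. f k)"
        using k assms(1) by (intro sum_mono2) auto
      finally show ?thesis using k by simp
    qed
    then have "summable (\<lambda>i. f (i + m))"
      using assms(1) by (intro summableI_nonneg_bounded[of _ B]) auto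
    then show False using assms(2) summable_iff_shift by blast
  qed
  then show ?thesis
    by (simp add: filterlim_at_top eventually_sequentially)
qed

text \<open>The divergence half of Borel--Cantelli with approximate pairwise independence at
  distance \<open>l\<close>. The second moment bound \<open>\<epsilon> + 2 * l / S n\<close> tends
  to \<open>\<epsilon>\<close> as the expected count diverges, so no occurrence from any
  \<open>m\<close> on has probability zero.\<close>

lemma (in prob_space) prob_frequently_eq_1:
  fixes A :: "nat \<Rightarrow> 'a set"
  assumes A: "\<And>k. A k \<in> events"
    and div: "\<not> summable (\<lambda>k. prob (A k))"
    and pair: "\<And>\<epsilon>. \<epsilon> > 0 \<Longrightarrow> \<exists>m. \<forall>j\<ge>m. \<forall>k\<ge>j + l.
      prob (A j \<inter> A k) \<le> (1 + \<epsilon>) * (prob (A j) * prob (A k))"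
  shows "prob {\<omega>\<in>space M. \<exists>\<^sub>F k in sequentially. \<omega> \<in> A k} = 1"
proof -
  note [measurable] = A
  define C where "C m = {\<omega>\<in>space M. \<forall>k\<ge>m. \<omega> \<notin> A k}" for m
  have [measurable]: "C m \<in> events" for m
    unfolding C_def by measurable
  have C: "prob (C m) = 0" for m
  proof (rule ccontr)
    assume "prob (C m) \<noteq> 0"
    then have pos: "prob (C m) > 0" by (simp add: zero_less_measure_iff)
    \<comment> \<open>In the limit the bound becomes \<open>prob (C m) \<le> \<epsilon>\<close>,
      which half of a positive number contradicts.\<close>
    define \<epsilon> where "\<epsilon> = prob (C m) / 2"
    have "\<epsilon> > 0" using pos by (simp add: \<epsilon>_def)
    obtain m0 where m0: "\<And>j k. j \<ge> m0 \<Longrightarrow> j + l \<le> k \<Longrightarrow>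
      prob (A j \<inter> A k) \<le> (1 + \<epsilon>) * (prob (A j) * prob (A k))"
      using pair[OF \<open>\<epsilon> > 0\<close>] by blast
    define m' where "m' = max m m0"
    define S where "S n = (\<Sum>k\<in>{m'..<n}. prob (A k))" for n
    have S: "filterlim S at_top sequentially"
      unfolding S_def using div by (intro filterlim_partial_sums_at_top) auto
    have "prob (C m) \<le> \<epsilon> + 2 * real l / S n" if "S n > 0" for n
    proof -
      have "prob (C m) \<le> prob {\<omega>\<in>space M. \<forall>k\<in>{m'..<n}. \<omega> \<notin> A k}"
        by (intro finite_measure_mono) (auto simp: C_def m'_def)
      also have "\<dots> \<le> \<epsilon> + 2 * real l / S n"
        using \<open>\<epsilon> > 0\<close> that by (intro prob_no_event_le[OF A m0]) (auto simp: S_def m'_def)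
      finally show ?thesis .
    qed
    moreover have "eventually (\<lambda>n. S n > 0) sequentially"
      using S by (simp add: filterlim_at_top_dense)
    ultimately have "eventually (\<lambda>n. prob (C m) \<le> \<epsilon> + 2 * real l / S n) sequentially"
      by (auto elim: eventually_mono)
    moreover have "((\<lambda>n. \<epsilon> + 2 * real l / S n) \<longlongrightarrow> \<epsilon> + 0) sequentially"
      by (intro tendsto_intros real_tendsto_divide_at_top[OF tendsto_const S])
    ultimately have "prob (C m) \<le> \<epsilon> + 0"
      by (intro tendsto_lowerbound) auto
    then show False using pos by (simp add: \<epsilon>_def)
  qed
  have "AE \<omega> in M. \<omega> \<notin> C m" for m
    using C[of m] by (intro AE_not_in) (simp add: null_sets_def emeasure_eq_measure)
  then have "AE \<omega> in M. \<forall>m. \<omega> \<notin> C m"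
    by (simp add: AE_all_countable)
  then have "AE \<omega> in M. \<exists>\<^sub>F k in sequentially. \<omega> \<in> A k"
    by (rule AE_mp) (auto simp: C_def frequently_sequentially)
  moreover have "{\<omega>\<in>space M. \<exists>\<^sub>F k in sequentially. \<omega> \<in> A k} \<in> events"
    unfolding frequently_sequentially by measurable
  ultimately show ?thesis by (simp add: prob_Collect_eq_1)
qed

lemma (in prob_space) prob_frequently_eq_0:
  fixes A :: "nat \<Rightarrow> 'a set"
  assumes A: "\<And>k. A k \<in> events" and "summable (\<lambda>k. prob (A k))"
  shows "prob {\<omega>\<in>space M. \<exists>\<^sub>F k in sequentially. \<omega> \<in> A k} = 0"
proof -
  note [measurable] = A
  have "AE \<omega> in M. eventually (\<lambda>k. \<omega> \<in> space M - A k) sequentially"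
    using assms by (intro borel_cantelli_AE1) (auto simp: emeasure_eq_measure)
  then have "AE \<omega> in M. \<not> (\<exists>\<^sub>F k in sequentially. \<omega> \<in> A k)"
    by (rule AE_mp) (auto simp: frequently_def elim: eventually_mono)
  moreover have "{\<omega>\<in>space M. \<exists>\<^sub>F k in sequentially. \<omega> \<in> A k} \<in> events"
    unfolding frequently_sequentially by measurable
  ultimately show ?thesis by (simp add: prob_Collect_eq_0)
qed

section \<open>Tails of a positive distribution on the natural numbers\<close>

locale positive_distribution =
  fixes p :: "nat \<Rightarrow> real"
  assumes p_pos: "p i > 0" and p_sums: "p sums 1"
begin

abbreviation "G \<equiv> tail_sum p"

lemma summable_shifted: "summable (\<lambda>i. p (n + i))"
  using p_sums sums_summable summable_iff_shift[of p n] by (simp add: add.commute)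

lemma tail_sum_eq: "G n = 1 - (\<Sum>i<n. p i)"
  using suminf_split_initial_segment[of p n] sums_summable[OF p_sums] sums_unique[OF p_sums]
  by (simp add: tail_sum_def add.commute)

lemma tail_sum_0: "G 0 = 1"
  by (simp add: tail_sum_eq)

lemma tail_sum_pos: "G n > 0"
  unfolding tail_sum_def by (intro suminf_pos summable_shifted p_pos)

lemma tail_sum_less: "m < n \<Longrightarrow> G n < G m"
  unfolding tail_sum_eq using p_pos less_imp_le[OF p_pos]
  by (intro diff_strict_left_mono sum_strict_mono2[where b = m]) auto

lemma tail_sum_mono: "m \<le> n \<Longrightarrow> G n \<le> G m"
  using tail_sum_less[of m n] by (cases "m = n") auto

lemma tail_sum_le_1: "G n \<le> 1"
  using tail_sum_mono[of 0 n] by (simp add: tail_sum_0)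

lemma tail_sum_tendsto_0: "G \<longlonglongrightarrow> 0"
proof -
  have "(\<lambda>n. 1 - (\<Sum>i<n. p i)) \<longlonglongrightarrow> 1 - 1"
    using p_sums by (intro tendsto_intros) (simp add: sums_def)
  then show ?thesis by (simp add: tail_sum_eq[abs_def])
qed

lemma finite_tail_sum_ge: "c > 0 \<Longrightarrow> finite {k. G k \<ge> c}"
proof -
  assume "c > 0"
  then have "eventually (\<lambda>k. G k < c) sequentially"
    by (rule order_tendstoD(2)[OF tail_sum_tendsto_0])
  then obtain K where "\<And>k. k \<ge> K \<Longrightarrow> G k < c"
    by (auto simp: eventually_sequentially)
  then have "{k. G k \<ge> c} \<subseteq> {..<K}"
    by (force simp: not_less[symmetric])
  then show ?thesis using finite_subset by blast
qed

text \<open>As \<open>G\<close> decreases from 1 to 0, the set whose maximum is taken is a finite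
  initial segment containing 0.\<close>

lemma le_a_seq_iff:
  assumes "n \<ge> 1"
  shows "k \<le> a_seq p n \<longleftrightarrow> 1 / real n \<le> G k"
proof -
  let ?S = "{k. 1 / real n \<le> G k}"
  have S: "finite ?S" "?S \<noteq> {}"
    using assms tail_sum_0 by (auto intro!: finite_tail_sum_ge exI[of _ 0])
  have "G (Max ?S) \<ge> 1 / real n" using Max_in[OF S] by simp
  moreover have "G (Max ?S) \<le> G k" if "k \<le> Max ?S"
    using tail_sum_mono[OF that] .
  ultimately show ?thesis
    unfolding a_seq_def using Max_ge[OF S(1), of k] by fastforce
qed

lemma exp_R_fun: "exp (- R_fun p n) = G n"
  by (simp add: R_fun_def tail_sum_pos)

lemma tail_sum_divide: "G m / G n = exp (R_fun p n - R_fun p m)"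
  by (simp add: exp_diff exp_minus field_simps flip: exp_R_fun)

lemma tail_sum_Suc: "G (Suc n) = G n * exp (- r_fun p (Suc n))"
  unfolding exp_R_fun[symmetric] r_fun_def by (simp flip: exp_add)

lemma R_fun_Suc: "R_fun p (Suc n) = R_fun p n + r_fun p (Suc n)"
  by (simp add: r_fun_def)

lemma R_fun_diff: "R_fun p (m + n) - R_fun p m = (\<Sum>i<n. r_fun p (Suc (m + i)))"
  by (induction n) (simp_all add: R_fun_Suc)

end

section \<open>Tail decay when \<open>r\<close> increases to infinity\<close>

locale increasing_hazard = positive_distribution +
  assumes r_mono: "mono_on {1..} (r_fun p)"
    and r_at_top: "filterlim (r_fun p) at_top sequentially"
begin

lemma r_fun_mono: "1 \<le> m \<Longrightarrow> m \<le> n \<Longrightarrow> r_fun p m \<le> r_fun p n"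
  using r_mono by (auto simp: mono_on_def)

text \<open>The difference telescopes into \<open>n\<close> increments \<open>r\<close>, the last
  being the largest. With \<open>n = l - 1\<close> this controls
  \<open>G (Suc m) / G (m + l)\<close>, the main term in the exponent of
  \<open>prob (low m)\<close>.\<close>

lemma R_fun_diff_le: 
  "R_fun p (Suc (m + n)) - R_fun p (Suc m) \<le> real n * r_fun p (Suc (m + n))"
proof -
  have "(\<Sum>i<n. r_fun p (Suc (Suc m + i))) \<le> (\<Sum>i<n. r_fun p (Suc (m + n)))"
    by (intro sum_mono r_fun_mono) auto
  then show ?thesis using R_fun_diff[of "Suc m" n] by simp
qed

lemma R_fun_diff_ge: 
  "R_fun p (Suc (m + n)) - R_fun p (Suc m) \<ge> real n * r_fun p (Suc (Suc m))"
proof -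
  have "(\<Sum>i<n. r_fun p (Suc (Suc m + i))) \<ge> (\<Sum>i<n. r_fun p (Suc (Suc m)))"
    by (intro sum_mono r_fun_mono) auto
  then show ?thesis using R_fun_diff[of "Suc m" n] by simp
qed

lemma tail_sum_ratio_tendsto_0: "(\<lambda>n. G (Suc n) / G n) \<longlonglongrightarrow> 0"
proof -
  have "(\<lambda>n. exp (- r_fun p (Suc n))) \<longlonglongrightarrow> 0"
    using r_at_top
    by (intro filterlim_compose[OF exp_at_bot] filterlim_compose[OF filterlim_uminus_at_bot_at_top])
      (simp add: filterlim_sequentially_Suc)
  moreover have "G n \<noteq> 0" for n using tail_sum_pos[of n] by simp
  ultimately show ?thesis by (simp add: tail_sum_Suc)
qed

text \<open>Once the increments of \<open>R\<close> are at least 2, from \<open>K\<close> on,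
  \<open>R\<close> gains \<open>2 * (n - K)\<close>, which is at least \<open>n\<close> for
  \<open>n \<ge> 2 * K\<close>. So slope 2 pays for the late start.\<close>

lemma eventually_tail_sum_le: "eventually (\<lambda>n. G n \<le> exp (- real n)) sequentially"
proof -
  have "eventually (\<lambda>n. r_fun p n \<ge> 2) sequentially"
    using r_at_top by (simp add: filterlim_at_top)
  then obtain K where K: "\<And>n. n \<ge> K \<Longrightarrow> r_fun p n \<ge> 2"
    by (auto simp: eventually_sequentially)
  have "G n \<le> exp (- real n)" if "n \<ge> 2 * K" for n
  proof -
    have "2 * real (n - K) \<le> (\<Sum>i<n-K. r_fun p (Suc (K + i)))"
      using sum_mono[of "{..<n-K}" "\<lambda>_. 2" "\<lambda>i. r_fun p (Suc (K + i))"] K by (simp add: mult.commute)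
    also have "\<dots> = R_fun p n - R_fun p K"
      using R_fun_diff[of K "n - K"] that by simp
    finally have "real n \<le> R_fun p n - R_fun p K" using that by (simp add: of_nat_diff)
    moreover have "R_fun p K \<ge> 0"
      using tail_sum_le_1[of K] tail_sum_pos[of K] by (simp add: R_fun_def)
    ultimately show ?thesis by (simp flip: exp_R_fun)
  qed
  then show ?thesis by (auto simp: eventually_sequentially)
qed

end

section \<open>Running maxima of an i.i.d. sample and the events \<open>low m\<close>\<close>

locale iid_sample = prob_space M + increasing_hazard p
  for M :: "'a measure" and p :: "nat \<Rightarrow> real" +
  fixes X :: "nat \<Rightarrow> 'a \<Rightarrow> nat" and l :: nat
  assumes indep: "indep_vars (\<lambda>_. count_space UNIV) X {1..}"
    and X_distr: "n \<ge> 1 \<Longrightarrow> prob {\<omega>\<in>space M. X n \<omega> = i} = p i"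
    and l_ge_1: "l \<ge> 1"
begin

lemma X_measurable: "i \<ge> 1 \<Longrightarrow> X i \<in> M \<rightarrow>\<^sub>M count_space UNIV"
  using indep by (auto simp: indep_vars_def)

lemma prob_X_le:
  assumes "i \<ge> 1"
  shows "prob (X i -` {..m} \<inter> space M) = 1 - G (Suc m)"
proof -
  note [measurable] = X_measurable[OF assms]
  have "X i -` {..m} \<inter> space M = (\<Union>j\<in>{..m}. {\<omega>\<in>space M. X i \<omega> = j})"
    by auto
  also have "prob \<dots> = (\<Sum>j\<in>{..m}. prob {\<omega>\<in>space M. X i \<omega> = j})"
    by (intro finite_measure_finite_Union) (auto simp: disjoint_family_on_def)
  finally show ?thesis
    using X_distr[OF assms] by (simp add: tail_sum_eq lessThan_Suc_atMost)
qed

lemma prob_all_X_le: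
  assumes "finite J" "J \<noteq> {}" "J \<subseteq> {1..}"
  shows "prob {\<omega>\<in>space M. \<forall>i\<in>J. X i \<omega> \<le> c i} = (\<Prod>i\<in>J. 1 - G (Suc (c i)))"
proof -
  have "{\<omega>\<in>space M. \<forall>i\<in>J. X i \<omega> \<le> c i} = (\<Inter>i\<in>J. X i -` {..c i} \<inter> space M)"
    using assms(2) by auto
  also have "prob \<dots> = (\<Prod>i\<in>J. prob (X i -` {..c i} \<inter> space M))"
    using assms by (intro indep_varsD[OF indep]) auto
  also have "\<dots> = (\<Prod>i\<in>J. 1 - G (Suc (c i)))"
    using assms by (intro prod.cong refl prob_X_le) auto
  finally show ?thesis .
qed

definition T :: "nat \<Rightarrow> nat"
  where "T m = nat \<lceil>1 / G (m + l)\<rceil>"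

definition low :: "nat \<Rightarrow> 'a set"
  where "low m = {\<omega>\<in>space M. \<forall>i\<in>{1..T m}. X i \<omega> \<le> m}"

text \<open>Both sides say \<open>1 / n \<le> G (m + l)\<close>; rounding
  \<open>1 / G (m + l)\<close> up does not affect comparison with an integer. This converts times
  \<open>n\<close> into levels \<open>m\<close>.\<close>

lemma T_le_iff: "n \<ge> 1 \<Longrightarrow> T m \<le> n \<longleftrightarrow> m + l \<le> a_seq p n"
  using tail_sum_pos[of "m + l"] by (simp add: le_a_seq_iff T_def nat_le_iff ceiling_le_iff field_simps)

lemma T_ge: "1 / G (m + l) \<le> real (T m)"
  unfolding T_def by (rule real_nat_ceiling_ge)

lemma T_le: "real (T m) \<le> 1 / G (m + l) + 1"
  using tail_sum_pos[of "m + l"] of_int_ceiling_le_add_one[of "1 / G (m + l)"]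
  by (simp add: T_def)

lemma T_pos: "T m \<ge> 1"
proof -
  have "1 / G (m + l) > 0" using tail_sum_pos[of "m + l"] by simp
  then have "real (T m) > 0" using T_ge[of m] by linarith
  then show ?thesis by simp
qed

lemma T_mono: "j \<le> k \<Longrightarrow> T j \<le> T k"
  using T_le_iff[of "T k" j] T_le_iff[of "T k" k] T_pos[of k] by simp

lemma low_measurable [measurable]: "low m \<in> events"
proof -
  have "low m = (\<Inter>i\<in>{1..T m}. X i -` {..m} \<inter> space M)"
    using T_pos[of m] by (auto simp: low_def)
  also have "\<dots> \<in> events"
  proof (rule sets.finite_INT)
    show "X i -` {..m} \<inter> space M \<in> events" if "i \<in> {1..T m}" for i
      using X_measurable[of i] that by (auto intro: measurable_sets)
  qed (use T_pos[of m] in auto)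
  finally show ?thesis .
qed

text \<open>An occurrence at time \<open>n\<close> gives \<open>low m\<close> at level
  \<open>m = a_seq p n - l\<close>, since \<open>T m \<le> n\<close>; conversely
  \<open>low m\<close> gives an occurrence at time \<open>T m\<close>. Subtraction is in
  \<open>int\<close>, so that a negative bound is never met.\<close>

lemma frequently_max_le_iff:
  assumes "\<omega> \<in> space M"
  shows "(\<exists>\<^sub>F n in sequentially. int (max_upto X n \<omega>) \<le> int (a_seq p n) - int l) \<longleftrightarrow>
    (\<exists>\<^sub>F m in sequentially. \<omega> \<in> low m)"
proof -
  have max_le: "max_upto X n \<omega> \<le> m \<longleftrightarrow> (\<forall>i\<in>{1..n}. X i \<omega> \<le> m)" if "n \<ge> 1" for n m
    using that unfolding max_upto_def by (subst Max_le_iff) auto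
  show ?thesis
    unfolding frequently_sequentially
  proof safe
    fix m0
    assume *: "\<forall>N. \<exists>n\<ge>N. int (max_upto X n \<omega>) \<le> int (a_seq p n) - int l"
    from * obtain n where n: "n \<ge> T m0" "int (max_upto X n \<omega>) \<le> int (a_seq p n) - int l" by blast
    define m where "m = a_seq p n - l"
    have "n \<ge> 1" using n(1) T_pos[of m0] by simp
    have "m0 + l \<le> a_seq p n" using T_le_iff[of n m0] n(1) \<open>n \<ge> 1\<close> by simp
    then have m: "m0 \<le> m" "m + l = a_seq p n" by (simp_all add: m_def)
    then have "T m \<le> n" using T_le_iff[of n m] \<open>n \<ge> 1\<close> by simp
    moreover have "max_upto X n \<omega> \<le> m" using n(2) m by simp
    ultimately have "\<omega> \<in> low m"
      using assms \<open>n \<ge> 1\<close> by (auto simp: low_def max_le)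
    then show "\<exists>m\<ge>m0. \<omega> \<in> low m" using m(1) by blast
  next
    fix N
    assume *: "\<forall>m0. \<exists>m\<ge>m0. \<omega> \<in> low m"
    \<comment> \<open>Such an \<open>m\<close> exceeds \<open>a_seq p (Suc N)\<close>, hence
      \<open>T m > Suc N\<close>; \<open>Suc N\<close> serves to keep the time positive.\<close>
    from * obtain m where m: "m \<ge> Suc (a_seq p (Suc N))" "\<omega> \<in> low m" by blast
    have "max_upto X (T m) \<omega> \<le> m"
      using m(2) T_pos[of m] by (auto simp: low_def max_le)
    moreover have "m + l \<le> a_seq p (T m)" using T_le_iff[of "T m" m] T_pos[of m] by simp
    moreover have "N \<le> T m" using T_le_iff[of "Suc N" m] m(1) by simp
    ultimately show "\<exists>n\<ge>N. int (max_upto X n \<omega>) \<le> int (a_seq p n) - int l"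
      by (intro exI[of _ "T m"]) simp
  qed
qed

lemma prob_low: "prob (low m) = (1 - G (Suc m)) ^ T m"
  unfolding low_def using T_pos[of m] by (subst prob_all_X_le) auto

text \<open>The first \<open>T j\<close> variables are bounded by \<open>j\<close> and the remaining
  ones by \<open>k\<close>. The extra factor supplies the \<open>T j\<close> factors missing from
  \<open>prob (low k)\<close>, so it measures the dependence exactly.\<close>

lemma prob_low_Int_low:
  assumes "j \<le> k"
  shows "prob (low j \<inter> low k) * (1 - G (Suc k)) ^ T j = prob (low j) * prob (low k)"
proof -
  have T: "T j \<le> T k" using assms by (rule T_mono)
  have "low j \<inter> low k = {\<omega>\<in>space M. \<forall>i\<in>{1..T k}. X i \<omega> \<le> (if i \<le> T j then j else k)}"
    using assms T by (fastforce simp: low_def split: if_splits)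
  then have "prob (low j \<inter> low k) = (\<Prod>i\<in>{1..T k}. 1 - G (Suc (if i \<le> T j then j else k)))"
    using T_pos[of k] by (simp add: prob_all_X_le)
  also have "{1..T k} = {1..T j} \<union> {T j<..T k}" using T by auto
  also have "(\<Prod>i\<in>\<dots>. 1 - G (Suc (if i \<le> T j then j else k))) =
      (1 - G (Suc j)) ^ T j * (1 - G (Suc k)) ^ (T k - T j)"
    by (subst prod.union_disjoint) auto
  finally have "prob (low j \<inter> low k) = (1 - G (Suc j)) ^ T j * (1 - G (Suc k)) ^ (T k - T j)" .
  moreover have "(1 - G (Suc k)) ^ (T k - T j) * (1 - G (Suc k)) ^ T j = (1 - G (Suc k)) ^ T k"
    using T by (simp flip: power_add)
  ultimately show ?thesis by (simp add: prob_low mult.assoc)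
qed

text \<open>It suffices that \<open>(1 - G (Suc k)) ^ T j\<close> is near 1. By Bernoulli's
  inequality its defect is at most \<open>T j * G (Suc k)\<close>, which is at most
  \<open>2 * (G (Suc k) / G k)\<close> because \<open>G k \<le> G (j + l)\<close>.\<close>

lemma asymptotically_independent:
  assumes "\<epsilon> > 0"
  shows "\<exists>m. \<forall>j\<ge>m. \<forall>k\<ge>j + l.
    prob (low j \<inter> low k) \<le> (1 + \<epsilon>) * (prob (low j) * prob (low k))"
proof -
  \<comment> \<open>Solves \<open>(1 + \<epsilon>) * (1 - 2 * \<delta>) = 1\<close>; one
    \<open>\<delta>\<close> is for \<open>1 / G (j + l)\<close>, the other for the rounding in
    \<open>T j\<close>.\<close>
  define \<delta> where "\<delta> = \<epsilon> / (1 + \<epsilon>) / 2"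
  have "\<delta> > 0" using assms by (simp add: \<delta>_def)
  have \<delta>: "(1 + \<epsilon>) * (1 - 2 * \<delta>) = 1" using assms by (simp add: \<delta>_def field_simps)
  obtain m where m: "\<And>n. n \<ge> m \<Longrightarrow> G (Suc n) / G n < \<delta>"
    using order_tendstoD(2)[OF tail_sum_ratio_tendsto_0 \<open>\<delta> > 0\<close>] by (auto simp: eventually_sequentially)
  have "prob (low j \<inter> low k) \<le> (1 + \<epsilon>) * (prob (low j) * prob (low k))"
    if jk: "j \<ge> m" "k \<ge> j + l" for j k
  proof -
    have "G (Suc k) / G (j + l) \<le> G (Suc k) / G k"
      using tail_sum_mono[OF jk(2)] tail_sum_pos by (intro divide_left_mono) (auto intro: less_imp_le)
    moreover have "G (Suc k) \<le> G (Suc k) / G k"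
      using tail_sum_le_1[of k] tail_sum_pos[of k] tail_sum_pos[of "Suc k"] by (simp add: field_simps)
    moreover have "G (Suc k) / G k < \<delta>" using m jk by simp
    moreover have "real (T j) * G (Suc k) \<le> (1 / G (j + l) + 1) * G (Suc k)"
      using T_le[of j] tail_sum_pos[of "Suc k"] by (intro mult_right_mono) auto
    ultimately have "real (T j) * G (Suc k) \<le> 2 * \<delta>" by (simp add: algebra_simps)
    moreover have "1 + real (T j) * (- G (Suc k)) \<le> (1 + (- G (Suc k))) ^ T j"
      using tail_sum_le_1[of "Suc k"] by (intro Bernoulli_inequality) simp
    ultimately have "1 - 2 * \<delta> \<le> (1 - G (Suc k)) ^ T j" by simp
    then have "prob (low j \<inter> low k) * (1 - 2 * \<delta>) \<le> prob (low j \<inter> low k) * (1 - G (Suc k)) ^ T j"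
      by (intro mult_left_mono) auto
    also have "\<dots> = prob (low j) * prob (low k)"
      using jk by (intro prob_low_Int_low) simp
    finally have "(1 + \<epsilon>) * (prob (low j \<inter> low k) * (1 - 2 * \<delta>)) \<le> (1 + \<epsilon>) * (prob (low j) * prob (low k))"
      using assms by (intro mult_left_mono) auto
    moreover have "(1 + \<epsilon>) * (prob (low j \<inter> low k) * (1 - 2 * \<delta>)) = prob (low j \<inter> low k)"
      using \<delta> by (metis mult.left_commute mult.right_neutral)
    ultimately show ?thesis by simp
  qed
  then show ?thesis by blast
qed

section \<open>Comparing \<open>prob (low m)\<close> with the terms of the series\<close>

text \<open>Combines \<open>1 - x \<le> exp (- x)\<close> with
  \<open>T m * G (Suc m) \<ge> G (Suc m) / G (m + l)\<close>; the latter ratio is the exponential of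
  \<open>l - 1\<close> increments, the first being the smallest.\<close>

lemma prob_low_le: "prob (low m) \<le> exp (- exp ((real l - 1) * r_fun p (Suc (Suc m))))"
proof -
  obtain d where d: "l = Suc d" using l_ge_1 by (cases l) auto
  have "prob (low m) \<le> exp (- G (Suc m)) ^ T m"
    unfolding prob_low using exp_ge_add_one_self[of "- G (Suc m)"] tail_sum_le_1[of "Suc m"]
    by (intro power_mono) auto
  also have "\<dots> = exp (- (real (T m) * G (Suc m)))"
    by (simp flip: exp_of_nat_mult)
  also have "\<dots> \<le> exp (- exp ((real l - 1) * r_fun p (Suc (Suc m))))"
  proof -
    have "exp ((real l - 1) * r_fun p (Suc (Suc m))) \<le> G (Suc m) / G (m + l)"
      using R_fun_diff_ge[of d m] by (simp add: d tail_sum_divide)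
    also have "\<dots> = 1 / G (m + l) * G (Suc m)" by simp
    also have "\<dots> \<le> real (T m) * G (Suc m)"
      using T_ge[of m] tail_sum_pos[of "Suc m"] by (intro mult_right_mono) auto
    finally show ?thesis by simp
  qed
  finally show ?thesis .
qed

text \<open>The reverse bound uses \<open>ln (1 - x) \<ge> - x - 2 * x\<^sup>2\<close> for
  \<open>x \<le> 1 / 2\<close>. The number \<open>c\<close> caps the double exponential's inner
  value \<open>E\<close>, so that \<open>E * x \<le> 1\<close> and the quadratic error stays
  bounded.\<close>

lemma prob_low_ge:
  assumes le: "exp ((real l - 1) * r_fun p (m + l)) \<le> c" and c: "c * G (Suc m) \<le> 1"
    and half: "G (Suc m) \<le> 1 / 2"
  shows "prob (low m) \<ge> exp (- 4) * exp (- exp ((real l - 1) * r_fun p (m + l)))"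
proof -
  define x where "x = G (Suc m)"
  define E where "E = exp ((real l - 1) * r_fun p (m + l))"
  obtain d where d: "l = Suc d" using l_ge_1 by (cases l) auto
  have x: "0 < x" "x \<le> 1 / 2" using half tail_sum_pos by (auto simp: x_def)
  have "x / G (m + l) \<le> E"
    using R_fun_diff_le[of m d] by (simp add: d tail_sum_divide x_def E_def)
  then have Tx: "real (T m) * x \<le> E + x"
    using mult_right_mono[OF T_le[of m], of x] x by (simp add: algebra_simps)
  have "E * x \<le> c * x" using le x by (simp add: E_def)
  then have Ex: "E * x \<le> 1" using c by (simp add: x_def)
  have "real (T m) * (x + 2 * x\<^sup>2) = real (T m) * x * (1 + 2 * x)"
    by (simp add: algebra_simps power2_eq_square)
  also have "\<dots> \<le> (E + x) * (1 + 2 * x)"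
    using Tx x by (intro mult_right_mono) auto
  also have "\<dots> = E + 2 * (E * x) + x + 2 * (x * x)" by (simp add: algebra_simps)
  \<comment> \<open>The three error terms are at most 2, \<open>1 / 2\<close> and
    \<open>1 / 2\<close>; this is where the factor \<open>exp (- 4)\<close> comes from.\<close>
  also have "\<dots> \<le> E + 4"
    using Ex x mult_mono[of x "1/2" x "1/2"] by simp
  finally have *: "real (T m) * (x + 2 * x\<^sup>2) \<le> E + 4" .
  have "exp (- 4) * exp (- E) \<le> exp (real (T m) * (- x - 2 * x\<^sup>2))"
    using * by (simp add: algebra_simps flip: exp_add)
  also have "\<dots> \<le> exp (real (T m) * ln (1 - x))"
    using x by (simp add: mult_left_mono ln_one_minus_pos_lower_bound)
  also have "\<dots> = prob (low m)"
    using x by (simp add: prob_low x_def exp_of_nat_mult)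
  finally show ?thesis by (simp add: E_def)
qed

lemma summable_prob_low:
  assumes "summable (\<lambda>k. exp (- exp ((real l - 1) * r_fun p (Suc k))))"
  shows "summable (\<lambda>m. prob (low m))"
proof (rule summable_comparison_test')
  show "summable (\<lambda>m. exp (- exp ((real l - 1) * r_fun p (Suc (Suc m)))))"
    using assms by (subst (asm) summable_Suc_iff[symmetric])
  show "norm (prob (low m)) \<le> exp (- exp ((real l - 1) * r_fun p (Suc (Suc m))))" if "m \<ge> 0" for m
    using prob_low_le[of m] by simp
qed

text \<open>Terms with \<open>exp ((l - 1) r(m + l)) > m\<close> contribute only a convergent geometric part.
  In the others, \<open>T m * G (Suc m)\<^sup>2\<close> is bounded and \<open>(1 - x) ^ n \<approx> exp (- n x)\<close> up to a constant.\<close>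

lemma summable_if_summable_prob_low:
  assumes "summable (\<lambda>m. prob (low m))"
  shows "summable (\<lambda>k. exp (- exp ((real l - 1) * r_fun p (Suc k))))"
proof -
  let ?e = "\<lambda>m. exp (- exp ((real l - 1) * r_fun p (m + l)))"
  have "eventually (\<lambda>m. G (Suc m) \<le> exp (- real (Suc m))) sequentially"
    using eventually_tail_sum_le by (rule eventually_sequentially_Suc[THEN iffD2])
  moreover have "eventually (\<lambda>m. G (Suc m) < 1 / 2) sequentially"
    using order_tendstoD(2)[OF tail_sum_tendsto_0, of "1/2"]
    by (intro eventually_sequentially_Suc[THEN iffD2]) simp
  ultimately have "eventually (\<lambda>m. norm (?e m) \<le> exp 4 * prob (low m) + exp (- 1) ^ m) sequentially"
  proof eventually_elim
    case (elim m)
    show ?case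
    \<comment> \<open>The threshold \<open>real m\<close> plays the part of \<open>c\<close> in
      \<open>prob_low_ge\<close>: the decay of \<open>G\<close> is fast enough for
      \<open>real m * G (Suc m) \<le> 1\<close>.\<close>
    proof (cases "exp ((real l - 1) * r_fun p (m + l)) \<le> real m")
      case True
      have "real m * G (Suc m) \<le> real m * exp (- real m)"
        using elim by (intro mult_left_mono) (auto intro: order_trans)
      also have "\<dots> \<le> 1"
        using order_trans[OF _ exp_ge_add_one_self[of "real m"], of "real m"]
        by (simp add: exp_minus field_simps)
      finally have "prob (low m) \<ge> exp (- 4) * ?e m"
        using True elim by (intro prob_low_ge) auto
      then have "?e m \<le> exp 4 * prob (low m)" by (simp add: exp_minus field_simps)
      then show ?thesis by (simp add: add_increasing2)
    next
      case False
      then have "?e m \<le> exp (- real m)" by simp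
      also have "\<dots> = exp (- 1) ^ m" by (simp flip: exp_of_nat_mult)
      finally show ?thesis by (simp add: add_increasing)
    qed
  qed
  moreover have "summable (\<lambda>m. exp 4 * prob (low m) + exp (- 1) ^ m)"
    using assms by (intro summable_add summable_mult summable_geometric) auto
  ultimately have "summable ?e" by (rule summable_comparison_test_ev)
  then have "summable (\<lambda>k. exp (- exp ((real l - 1) * r_fun p k)))"
    by (subst (asm) summable_iff_shift)
  then show ?thesis by (subst (asm) summable_Suc_iff[symmetric])
qed

section \<open>The zero-one alternative and the theorem\<close>

lemma prob_frequently_max_le:
  "prob {\<omega>\<in>space M. \<exists>\<^sub>F n in sequentially. int (max_upto X n \<omega>) \<le> int (a_seq p n) - int l} =
    (if summable (\<lambda>k. exp (- exp ((real l - 1) * r_fun p (Suc k)))) then 0 else 1)"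
proof -
  have "{\<omega>\<in>space M. \<exists>\<^sub>F n in sequentially. int (max_upto X n \<omega>) \<le> int (a_seq p n) - int l} =
      {\<omega>\<in>space M. \<exists>\<^sub>F m in sequentially. \<omega> \<in> low m}"
    using frequently_max_le_iff by blast
  then show ?thesis
    using prob_frequently_eq_0[of low] prob_frequently_eq_1[of low l]
      asymptotically_independent summable_prob_low summable_if_summable_prob_low
    by auto
qed

end

theorem theorem2:
  fixes M :: "'a measure" and X :: "nat \<Rightarrow> 'a \<Rightarrow> nat" and p :: "nat \<Rightarrow> real" and l :: nat
  assumes "prob_space M"
    and "prob_space.indep_vars M (\<lambda>_. count_space UNIV) X {1..}"
    and "\<And>n i. n \<ge> 1 \<Longrightarrow> \<P>(\<omega> in M. X n \<omega> = i) = p i"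
    and "\<And>i. p i > 0"
    and "p sums 1"
    and "mono_on {1..} (r_fun p) \<or> antimono_on {1..} (r_fun p)"
    and "filterlim (r_fun p) at_top sequentially"
    and "l \<ge> 1"
  shows "(l = 1 \<longrightarrow>
            \<P>(\<omega> in M. \<exists>\<^sub>F n in sequentially. int (max_upto X n \<omega>) \<le> int (a_seq p n) - int l) = 1) \<and>
         (l > 1 \<longrightarrow>
            (summable (\<lambda>k. exp (- exp ((real l - 1) * r_fun p (Suc k)))) \<longrightarrow>
               \<P>(\<omega> in M. \<exists>\<^sub>F n in sequentially. int (max_upto X n \<omega>) \<le> int (a_seq p n) - int l) = 0) \<and>
            (\<not> summable (\<lambda>k. exp (- exp ((real l - 1) * r_fun p (Suc k)))) \<longrightarrow>
               \<P>(\<omega> in M. \<exists>\<^sub>F n in sequentially. int (max_upto X n \<omega>) \<le> int (a_seq p n) - int l) = 1))"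
proof -
  \<comment> \<open>A nonincreasing \<open>r\<close> would stay below \<open>r_fun p 1\<close> and
    could not tend to infinity, which leaves the nondecreasing case.\<close>
  have "\<not> antimono_on {1..} (r_fun p)"
  proof
    assume anti: "antimono_on {1..} (r_fun p)"
    have "eventually (\<lambda>n. r_fun p n > r_fun p 1) sequentially"
      using assms(7) by (simp add: filterlim_at_top_dense)
    then obtain n where "n \<ge> 1" "r_fun p n > r_fun p 1"
      unfolding eventually_sequentially by (meson nat_le_linear order_refl)
    then show False using monotone_onD[OF anti, of 1 n] by simp
  qed
  then have mono: "mono_on {1..} (r_fun p)" using assms(6) by blast
  interpret iid_sample M p X l
    using assms mono
    by (auto intro!: iid_sample.intro increasing_hazard.intro positive_distribution.intro
        increasing_hazard_axioms.intro iid_sample_axioms.intro)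
  \<comment> \<open>For \<open>l = 1\<close> the factor \<open>real l - 1\<close> vanishes and the
    series has this constant positive term.\<close>
  have "\<not> summable (\<lambda>k::nat. exp (- exp (0 :: real)))"
    by (simp add: summable_const_iff)
  then show ?thesis
    using prob_frequently_max_le by auto
qed

end
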